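(* Let $G$ be a connected graph with $n$ vertices and diameter $d$. (1) $mvc(G)=n$ if and only if $d\le 2$. (2) If $d\ge 3$, then $mvc(G)\le n-d+2$. This bound is sharp: for all integers $n,d$ with $3\le d\le n-1$ there is a connected graph $G_0$ with $n$ vertices and diameter $d$ such that $mvc(G_0)=n-d+2$.
   Context: All graphs are simple, finite, undirected and connected. The diameter of $G$ is the maximum distance between two vertices of $G$. A path in a vertex-colored graph is vertex-monochromatic if all its internal vertices have the same color (in particular, a path with at most one internal vertex is vertex-monochromatic). A vertex-coloring (not required to be proper) of a connected graph $G$ is an MVC-coloring if any two vertices of $G$ are joined by a vertex-monochromatic path. The monochromatic vertex-connection number $mvc(G)$ is the maximum number of colors used in an MVC-coloring of $G$. *)

theory Defs
  imports "Graph_Theory.Graph_Theory"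
begin

text \<open>
  A simple finite undirected graph is the locale \<^locale>\<open>graph\<close>: a finite symmetric digraph without
  loops and parallel arcs, so that every undirected edge is a pair of opposite arcs.
  A path is \<^const>\<open>pre_digraph.apath\<close>, the list of arcs of a walk without repeated vertices.
\<close>

definition vertex_distance :: "('a, 'b) pre_digraph \<Rightarrow> 'a \<Rightarrow> 'a \<Rightarrow> nat" where
  "vertex_distance G u v = (LEAST k. \<exists>p. pre_digraph.apath G u p v \<and> length p = k)"

definition graph_diameter :: "('a, 'b) pre_digraph \<Rightarrow> nat" where
  "graph_diameter G = Max {vertex_distance G u v | u v. u \<in> verts G \<and> v \<in> verts G}"

text \<open>
  \<^const>\<open>pre_digraph.inner_verts\<close> lists the internal vertices of a path. The condition is vacuous for
  paths with at most one of them.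
\<close>

definition vertex_monochromatic ::
    "('a, 'b) pre_digraph \<Rightarrow> ('a \<Rightarrow> 'c) \<Rightarrow> 'b awalk \<Rightarrow> bool" where
  "vertex_monochromatic G c p \<longleftrightarrow>
     (\<forall>x \<in> set (pre_digraph.inner_verts G p). \<forall>y \<in> set (pre_digraph.inner_verts G p). c x = c y)"

definition MVC_coloring :: "('a, 'b) pre_digraph \<Rightarrow> ('a \<Rightarrow> 'c) \<Rightarrow> bool" where
  "MVC_coloring G c \<longleftrightarrow>
     (\<forall>u \<in> verts G. \<forall>v \<in> verts G.
        \<exists>p. pre_digraph.apath G u p v \<and> vertex_monochromatic G c p)"

text \<open>
  The colors are natural numbers, which is no restriction as the graphs are finite. Only the
  colors of actual vertices are counted.
\<close>

definition mvc :: "('a, 'b) pre_digraph \<Rightarrow> nat" where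
  "mvc G = Max {card (c ` verts G) | c :: 'a \<Rightarrow> nat. MVC_coloring G c}"

text \<open>
  The maxima above are over finite nonempty sets, and \<^const>\<open>vertex_distance\<close> is the
  library's shortest path distance for unit weights.
\<close>

lemma (in graph) graph_diameter_set:
  assumes "connected G"
  shows "finite {vertex_distance G u v | u v. u \<in> verts G \<and> v \<in> verts G}"
    and "{vertex_distance G u v | u v. u \<in> verts G \<and> v \<in> verts G} \<noteq> {}"
proof -
  have "strongly_connected G"
    using assms symmetric_connected_imp_strongly_connected sym_arcs by blast
  then have ne: "verts G \<noteq> {}" by (simp add: strongly_connected_def)
  have eq: "{vertex_distance G u v | u v. u \<in> verts G \<and> v \<in> verts G}
      = (\<lambda>(u, v). vertex_distance G u v) ` (verts G \<times> verts G)" by auto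
  show "finite {vertex_distance G u v | u v. u \<in> verts G \<and> v \<in> verts G}"
    unfolding eq by simp
  show "{vertex_distance G u v | u v. u \<in> verts G \<and> v \<in> verts G} \<noteq> {}"
    unfolding eq using ne by simp
qed

lemma (in graph) mvc_set:
  assumes "connected G"
  shows "finite {card (c ` verts G) | c :: 'a \<Rightarrow> nat. MVC_coloring G c}"
    and "{card (c ` verts G) | c :: 'a \<Rightarrow> nat. MVC_coloring G c} \<noteq> {}"
proof -
  have sc: "strongly_connected G"
    using assms symmetric_connected_imp_strongly_connected sym_arcs by blast
  show "finite {card (c ` verts G) | c :: 'a \<Rightarrow> nat. MVC_coloring G c}"
    by (rule finite_subset[of _ "{..card (verts G)}"]) (auto intro: card_image_le)
  have "\<exists>p. apath u p v" if "u \<in> verts G" "v \<in> verts G" for u v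
    using sc that reachable_apath by (simp add: strongly_connected_def)
  then have "MVC_coloring G ((\<lambda>_. 0) :: 'a \<Rightarrow> nat)"
    unfolding MVC_coloring_def vertex_monochromatic_def by blast
  then show "{card (c ` verts G) | c :: 'a \<Rightarrow> nat. MVC_coloring G c} \<noteq> {}"
    by blast
qed

lemma (in graph) vertex_distance_eq_mu:
  assumes "u \<rightarrow>\<^sup>* v"
  shows "ereal (real (vertex_distance G u v)) = \<mu> (\<lambda>_. 1) u v"
proof -
  have cost: "awalk_cost (\<lambda>_. 1) p = real (length p)" for p :: "'b awalk"
    by (induct p) auto
  let ?P = "\<lambda>k. \<exists>p. apath u p v \<and> length p = k"
  have "\<exists>k. ?P k" using assms reachable_apath by auto
  then have "?P (vertex_distance G u v)"
    unfolding vertex_distance_def by (rule LeastI_ex)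
  then obtain p where p: "apath u p v" "length p = vertex_distance G u v" by blast
  have le: "vertex_distance G u v \<le> length q" if "awalk u q v" for q
  proof -
    have "apath u (awalk_to_apath q) v" using that by (rule apath_awalk_to_apath)
    then have "vertex_distance G u v \<le> length (awalk_to_apath q)"
      unfolding vertex_distance_def by (intro Least_le) blast
    also have "\<dots> = card (set (awalk_to_apath q))"
      using \<open>apath u (awalk_to_apath q) v\<close>
      by (simp add: distinct_card apath_def awalk_verts_conv distinct_map split: if_splits)
    also have "\<dots> \<le> card (set q)"
      using that by (intro card_mono awalk_to_apath_subset) auto
    also have "\<dots> \<le> length q" by (rule card_length)
    finally show ?thesis .
  qed
  show ?thesis
  proof (rule antisym)
    show "ereal (real (vertex_distance G u v)) \<le> \<mu> (\<lambda>_. 1) u v"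
      unfolding \<mu>_def by (rule INF_greatest) (auto simp: cost le)
    have "\<mu> (\<lambda>_. 1) u v \<le> ereal (awalk_cost (\<lambda>_. 1) p)"
      using p(1) awalkI_apath min_cost_le_walk_cost by blast
    then show "\<mu> (\<lambda>_. 1) u v \<le> ereal (real (vertex_distance G u v))"
      by (simp add: cost p(2))
  qed
qed

end

theory Submission
  imports Defs
begin

text \<open>
  The internal vertices of a path are distinct, so a path of length \<open>k \<ge> 1\<close> has \<open>k - 1\<close> of them.
  A monochromatic path between two vertices at distance \<open>d \<ge> 2\<close> therefore has at least \<open>d - 1\<close>
  vertices that share a color; the remaining \<open>n - (d - 1)\<close> vertices at best contribute a color
  each, which leaves at most \<open>n - d + 2\<close> colors (lemma \<open>mvc_add_diameter_le\<close>). For \<open>d \<ge> 3\<close> this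
  is less than \<open>n\<close>. If \<open>d \<le> 2\<close>, shortest paths have at most one internal vertex, so every
  coloring is an MVC-coloring, in particular one that gives all vertices different colors.

  The bound is attained by a broom: a path with vertices \<open>0, \<dots>, d\<close> whose end \<open>0\<close> is replaced by
  \<open>n - d\<close> leaves. An internal vertex of a path has two neighbors, hence is not a leaf, and the
  broom has only the \<open>d - 1\<close> non-leaves \<open>1, \<dots>, d - 1\<close>. So a coloring is an MVC-coloring as soon
  as it is constant on these, and the leaves are free to use \<open>n - d + 1\<close> further colors. The
  same observation bounds the length of every path in the broom by \<open>d\<close>.
\<close>

section \<open>Internal vertices, distances and colorings\<close>

lemma card_image_le_if_constant_on:
  assumes "finite A" and "D \<subseteq> A" and "D \<noteq> {}"
    and "\<And>x y. x \<in> D \<Longrightarrow> y \<in> D \<Longrightarrow> c x = c y"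
  shows "card (c ` A) + card D \<le> card A + 1"
proof -
  obtain a where "a \<in> D" using assms(3) by blast
  have "c ` A \<subseteq> insert (c a) (c ` (A - D))"
    using assms(4)[OF _ \<open>a \<in> D\<close>] by blast
  then have "card (c ` A) \<le> card (insert (c a) (c ` (A - D)))"
    using assms(1) by (intro card_mono) auto
  also have "\<dots> \<le> Suc (card (c ` (A - D)))" by (rule card_insert_le_m1) auto
  also have "card (c ` (A - D)) \<le> card (A - D)"
    using assms(1) by (intro card_image_le) auto
  also have "card (A - D) = card A - card D"
    using assms(1,2) by (intro card_Diff_subset) (auto intro: finite_subset)
  finally show ?thesis
    using card_mono[OF assms(1,2)] by simp
qed

lemma (in pre_digraph) length_inner_verts: "length (inner_verts p) = length p - 1"
  by (simp add: inner_verts_def)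

context wf_digraph
begin

lemma card_inner_verts:
  assumes "apath u p v"
  shows "card (set (inner_verts p)) = length p - 1"
proof -
  have "distinct (inner_verts p)"
    using assms unfolding apath_def inner_verts_conv[of p u]
    by (simp add: distinct_tl distinct_butlast)
  then show ?thesis by (simp add: distinct_card length_inner_verts)
qed

lemma inner_verts_subset_verts:
  assumes "apath u p v"
  shows "set (inner_verts p) \<subseteq> verts G"
proof -
  have "set (awalk_verts u p) \<subseteq> verts G"
    using assms unfolding apath_def by blast
  then show ?thesis unfolding set_inner_verts[OF assms] by blast
qed

text \<open>
  The two neighbors are the predecessor and the successor on the path, which differ because a
  path repeats no vertex. In particular, no path passes through a leaf.
\<close>

lemma inner_vertex_has_two_neighbors:
  assumes "apath u p v" and "x \<in> set (inner_verts p)"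
  shows "\<exists>y z. y \<noteq> z \<and> y \<rightarrow>\<^bsub>G\<^esub> x \<and> x \<rightarrow>\<^bsub>G\<^esub> z"
  using assms
proof (induction p arbitrary: u)
  case Nil
  then show ?case by simp
next
  case (Cons e es)
  then obtain f fs where es: "es = f # fs"
    by (cases es) auto
  have arcs: "e \<in> arcs G" "f \<in> arcs G" and f: "tail G f = head G e"
    and tail: "apath (head G e) es v" "tail G e \<notin> set (awalk_verts (head G e) es)"
    using Cons.prems(1) by (auto simp: es apath_Cons_iff)
  show ?case
  proof (cases "x = head G e")
    case True
    have "head G f \<in> set (awalk_verts (head G e) es)"
      using tail(1) by (cases fs) (auto simp: es apath_Cons_iff)
    then have "tail G e \<noteq> head G f" using tail(2) by auto
    moreover have "tail G e \<rightarrow>\<^bsub>G\<^esub> x" "x \<rightarrow>\<^bsub>G\<^esub> head G f"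
      using arcs f True by (auto simp: arc_to_ends_def intro: dominatesI)
    ultimately show ?thesis by blast
  next
    case False
    then have "x \<in> set (inner_verts es)"
      using Cons.prems(2) arcs f by (auto simp: es inner_verts_def)
    then show ?thesis using Cons.IH tail(1) by blast
  qed
qed

lemma level_le_add_length:
  fixes level :: "'a \<Rightarrow> nat"
  assumes "\<And>e. e \<in> arcs G \<Longrightarrow> level (head G e) \<le> Suc (level (tail G e))"
    and "awalk u p v"
  shows "level v \<le> level u + length p"
  using assms(2)
proof (induction p arbitrary: u)
  case Nil
  then show ?case by (simp add: awalk_Nil_iff)
next
  case (Cons e es)
  then show ?case using assms(1)[of e] by (force simp: awalk_Cons_iff)
qed

end

lemma (in pre_digraph) vertex_distance_le_length:
  "apath u p v \<Longrightarrow> vertex_distance G u v \<le> length p"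
  unfolding vertex_distance_def by (rule Least_le) blast

context graph
begin

lemma shortest_apath:
  assumes "connected G" and "u \<in> verts G" and "v \<in> verts G"
  obtains p where "apath u p v" and "length p = vertex_distance G u v"
proof -
  have "strongly_connected G"
    using assms(1) symmetric_connected_imp_strongly_connected sym_arcs by blast
  then have "\<exists>k p. apath u p v \<and> length p = k"
    using assms(2,3) reachable_apath by (simp add: strongly_connected_def)
  then have "\<exists>p. apath u p v \<and> length p = vertex_distance G u v"
    unfolding vertex_distance_def by (rule LeastI_ex)
  then show ?thesis using that by blast
qed

lemma vertex_distance_le_diameter:
  assumes "connected G" and "u \<in> verts G" and "v \<in> verts G"
  shows "vertex_distance G u v \<le> graph_diameter G"
  unfolding graph_diameter_def
  by (rule Max_ge[OF graph_diameter_set(1)[OF assms(1)]]) (use assms(2,3) in blast)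

lemma diameter_attained:
  assumes "connected G"
  obtains u v where "u \<in> verts G" and "v \<in> verts G" and "vertex_distance G u v = graph_diameter G"
proof -
  have "graph_diameter G \<in> {vertex_distance G u v | u v. u \<in> verts G \<and> v \<in> verts G}"
    unfolding graph_diameter_def by (rule Max_in[OF graph_diameter_set[OF assms]])
  then obtain u v where "graph_diameter G = vertex_distance G u v" "u \<in> verts G" "v \<in> verts G"
    by blast
  then show ?thesis using that by simp
qed

lemma card_colors_le_mvc:
  assumes "connected G" and "MVC_coloring G (c :: 'a \<Rightarrow> nat)"
  shows "card (c ` verts G) \<le> mvc G"
  unfolding mvc_def by (rule Max_ge[OF mvc_set(1)[OF assms(1)]]) (use assms(2) in blast)

lemma mvc_attained:
  assumes "connected G"
  obtains c :: "'a \<Rightarrow> nat" where "MVC_coloring G c" and "card (c ` verts G) = mvc G"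
proof -
  have "mvc G \<in> {card (c ` verts G) | c :: 'a \<Rightarrow> nat. MVC_coloring G c}"
    unfolding mvc_def by (rule Max_in[OF mvc_set[OF assms]])
  then obtain c :: "'a \<Rightarrow> nat" where "mvc G = card (c ` verts G)" "MVC_coloring G c"
    by blast
  then show ?thesis using that by simp
qed

section \<open>The upper bound and the graphs of diameter at most two\<close>

lemma mvc_le_card_verts:
  assumes "connected G"
  shows "mvc G \<le> card (verts G)"
proof -
  obtain c :: "'a \<Rightarrow> nat" where "card (c ` verts G) = mvc G"
    using mvc_attained[OF assms] .
  then show ?thesis using card_image_le[OF finite_verts] by metis
qed

text \<open>
  A diametral pair forces \<open>graph_diameter G - 1\<close> vertices of one color. The lower bound on the
  diameter makes sure that there is at least one such vertex.
\<close>

lemma mvc_add_diameter_le: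
  assumes "connected G" and "2 \<le> graph_diameter G"
  shows "mvc G + graph_diameter G \<le> card (verts G) + 2"
proof -
  obtain u v where uv: "u \<in> verts G" "v \<in> verts G" "vertex_distance G u v = graph_diameter G"
    using diameter_attained[OF assms(1)] .
  obtain c :: "'a \<Rightarrow> nat" where c: "MVC_coloring G c" "card (c ` verts G) = mvc G"
    using mvc_attained[OF assms(1)] .
  obtain p where p: "apath u p v" "vertex_monochromatic G c p"
    using c(1) uv(1,2) unfolding MVC_coloring_def by blast
  let ?D = "set (inner_verts p)"
  have D: "graph_diameter G - 1 \<le> card ?D"
    using vertex_distance_le_length[OF p(1)] uv(3) by (simp add: card_inner_verts[OF p(1)])
  with assms(2) have "?D \<noteq> {}" by auto
  moreover have "c x = c y" if "x \<in> ?D" "y \<in> ?D" for x y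
    using p(2) that unfolding vertex_monochromatic_def by blast
  ultimately have "card (c ` verts G) + card ?D \<le> card (verts G) + 1"
    by (rule card_image_le_if_constant_on[OF finite_verts inner_verts_subset_verts[OF p(1)]])
  then show ?thesis using D c(2) assms(2) by linarith
qed

lemma MVC_coloring_if_diameter_le_2:
  assumes "connected G" and "graph_diameter G \<le> 2"
  shows "MVC_coloring G c"
  unfolding MVC_coloring_def
proof (intro ballI)
  fix u v
  assume uv: "u \<in> verts G" "v \<in> verts G"
  obtain p where p: "apath u p v" "length p = vertex_distance G u v"
    using shortest_apath[OF assms(1) uv] .
  have "card (set (inner_verts p)) \<le> 1"
    using vertex_distance_le_diameter[OF assms(1) uv] assms(2) p(2)
    by (simp add: card_inner_verts[OF p(1)])
  then have "vertex_monochromatic G c p"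
    unfolding vertex_monochromatic_def by (auto simp: card_le_Suc0_iff_eq)
  with p(1) show "\<exists>p. apath u p v \<and> vertex_monochromatic G c p" by blast
qed

lemma mvc_eq_card_verts_iff:
  assumes "connected G"
  shows "mvc G = card (verts G) \<longleftrightarrow> graph_diameter G \<le> 2"
proof
  assume "mvc G = card (verts G)"
  then show "graph_diameter G \<le> 2"
    using mvc_add_diameter_le[OF assms] by linarith
next
  assume d: "graph_diameter G \<le> 2"
  obtain c :: "'a \<Rightarrow> nat" where "inj_on c (verts G)"
    using finite_imp_inj_to_nat_seg[OF finite_verts] by blast
  then have "card (verts G) \<le> mvc G"
    using card_colors_le_mvc[OF assms MVC_coloring_if_diameter_le_2[OF assms d], of c]
    by (simp add: card_image)
  then show "mvc G = card (verts G)"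
    using mvc_le_card_verts[OF assms] by simp
qed

end

section \<open>Brooms attain the bound\<close>

definition broom_level :: "nat \<Rightarrow> nat \<Rightarrow> nat" where
  "broom_level d x = (if x \<le> d then x else 0)"

text \<open>
  The vertices \<open>d + 1, \<dots>, n - 1\<close> are copies of the end \<open>0\<close> of the path \<open>0, \<dots>, d\<close>. Joining
  consecutive levels makes all of level \<open>0\<close> leaves at the vertex \<open>1\<close>.
\<close>

definition broom :: "nat \<Rightarrow> nat \<Rightarrow> (nat, nat \<times> nat) pre_digraph" where
  "broom n d =
    \<lparr> verts = {..<n},
      arcs = {(x, y). x < n \<and> y < n \<and>
        (broom_level d y = Suc (broom_level d x) \<or> broom_level d x = Suc (broom_level d y))},
      tail = fst, head = snd \<rparr>"

lemma verts_broom: "verts (broom n d) = {..<n}"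
  by (simp add: broom_def)

lemma dominates_broom_iff:
  "x \<rightarrow>\<^bsub>broom n d\<^esub> y \<longleftrightarrow> x < n \<and> y < n \<and>
    (broom_level d y = Suc (broom_level d x) \<or> broom_level d x = Suc (broom_level d y))"
  unfolding broom_def arcs_ends_conv by (simp add: image_iff)

lemma graph_broom: "graph (broom n d)"
proof -
  have "finite (arcs (broom n d))"
    by (rule finite_subset[of _ "{..<n} \<times> {..<n}"]) (auto simp: broom_def)
  moreover have "symmetric (broom n d)"
    unfolding symmetric_def sym_def by (simp add: dominates_broom_iff) blast
  ultimately show ?thesis
    by unfold_locales (simp_all add: broom_def arc_to_ends_def split_beta, auto)
qed

lemma connected_broom:
  assumes "1 \<le> d" and "d < n"
  shows "connected (broom n d)"
proof -
  interpret graph "broom n d" by (rule graph_broom)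
  have path: "0 \<rightarrow>\<^sup>*\<^bsub>broom n d\<^esub> x" if "x \<le> d" for x
    using that
  proof (induction x)
    case 0
    then show ?case using assms by (simp add: verts_broom)
  next
    case (Suc x)
    moreover have "x \<rightarrow>\<^bsub>broom n d\<^esub> Suc x"
      using Suc.prems assms by (simp add: dominates_broom_iff broom_level_def)
    ultimately show ?case using reachable_adj_trans by fastforce
  qed
  have from_0: "0 \<rightarrow>\<^sup>*\<^bsub>broom n d\<^esub> x" if "x < n" for x
  proof (cases "x \<le> d")
    case True
    then show ?thesis by (rule path)
  next
    case False
    then have "1 \<rightarrow>\<^bsub>broom n d\<^esub> x"
      using assms that by (simp add: dominates_broom_iff broom_level_def)
    then show ?thesis using path[OF assms(1)] reachable_adj_trans by blast
  qed
  have "u \<rightarrow>\<^sup>*\<^bsub>broom n d\<^esub> v" if "u < n" "v < n" for u v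
    using symmetric_reachable'[OF from_0[OF that(1)]] from_0[OF that(2)] by (rule reachable_trans)
  then show ?thesis
    using assms
    by (intro connectedI) (auto simp: verts_broom lessThan_empty_iff intro: reachable_mk_symmetricI)
qed

text \<open>
  The excluded vertices are leaves: a vertex of level \<open>0\<close> is adjacent only to \<open>1\<close>, the vertex
  \<open>d\<close> only to \<open>d - 1\<close>, provided that \<open>d \<ge> 2\<close>.
\<close>

lemma inner_verts_broom:
  assumes "2 \<le> d" and "pre_digraph.apath (broom n d) u p v"
  shows "set (pre_digraph.inner_verts (broom n d) p) \<subseteq> {1..<d}"
proof
  interpret graph "broom n d" by (rule graph_broom)
  fix x
  assume "x \<in> set (inner_verts p)"
  then obtain y z where "y \<noteq> z" "y \<rightarrow>\<^bsub>broom n d\<^esub> x" "x \<rightarrow>\<^bsub>broom n d\<^esub> z"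
    using inner_vertex_has_two_neighbors[OF assms(2)] by blast
  then show "x \<in> {1..<d}"
    using assms(1) by (auto simp: dominates_broom_iff broom_level_def split: if_splits)
qed

lemma diameter_broom:
  assumes "2 \<le> d" and "d < n"
  shows "graph_diameter (broom n d) = d"
proof (rule antisym)
  interpret graph "broom n d" by (rule graph_broom)
  have con: "connected (broom n d)" using assms by (intro connected_broom) auto
  obtain u v where uv: "u \<in> verts (broom n d)" "v \<in> verts (broom n d)"
    "vertex_distance (broom n d) u v = graph_diameter (broom n d)"
    using diameter_attained[OF con] .
  obtain p where p: "apath u p v" "length p = vertex_distance (broom n d) u v"
    using shortest_apath[OF con uv(1,2)] .
  have "length p - 1 \<le> card {1..<d}"
    using card_mono[OF _ inner_verts_broom[OF assms(1) p(1)]]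
    by (simp add: card_inner_verts[OF p(1)])
  then show "graph_diameter (broom n d) \<le> d" using p(2) uv(3) assms(1) by simp
next
  interpret graph "broom n d" by (rule graph_broom)
  have con: "connected (broom n d)" using assms by (intro connected_broom) auto
  have ends: "0 \<in> verts (broom n d)" "d \<in> verts (broom n d)"
    using assms by (auto simp: verts_broom)
  obtain p where p: "apath 0 p d" "length p = vertex_distance (broom n d) 0 d"
    using shortest_apath[OF con ends] .
  have "broom_level d d \<le> broom_level d 0 + length p"
    by (rule level_le_add_length[OF _ awalkI_apath[OF p(1)]]) (auto simp: broom_def)
  then show "d \<le> graph_diameter (broom n d)"
    using vertex_distance_le_diameter[OF con ends] p(2) by (simp add: broom_level_def)
qed

lemma mvc_broom:
  assumes "2 \<le> d" and "d < n"
  shows "mvc (broom n d) + d = n + 2"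
proof (rule antisym)
  interpret graph "broom n d" by (rule graph_broom)
  have con: "connected (broom n d)" using assms by (intro connected_broom) auto
  show "mvc (broom n d) + d \<le> n + 2"
    using mvc_add_diameter_le[OF con] diameter_broom[OF assms] assms(1)
    by (simp add: verts_broom)
  \<comment> \<open>All non-leaves get the color of vertex \<open>1\<close> and every leaf its own number, so that exactly
    the colors \<open>2, \<dots>, d - 1\<close> are lost.\<close>
  define c :: "nat \<Rightarrow> nat" where "c x = (if x \<in> {1..<d} then 1 else x)" for x
  have "vertex_monochromatic (broom n d) c p" if "apath u p v" for u p v
    unfolding vertex_monochromatic_def c_def
    using inner_verts_broom[OF assms(1) that] by (auto simp: subset_iff)
  moreover have "\<exists>p. apath u p v" if "u \<in> verts (broom n d)" "v \<in> verts (broom n d)" for u v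
    using shortest_apath[OF con that] by blast
  ultimately have "MVC_coloring (broom n d) c"
    unfolding MVC_coloring_def by blast
  then have "card (c ` {..<n}) \<le> mvc (broom n d)"
    using card_colors_le_mvc[OF con] by (simp add: verts_broom)
  moreover have "{..<n} - {2..<d} \<subseteq> c ` {..<n}"
    by (auto simp: c_def intro!: rev_image_eqI)
  then have "card ({..<n} - {2..<d}) \<le> card (c ` {..<n})"
    by (intro card_mono) auto
  moreover have "card ({..<n} - {2..<d}) = n - (d - 2)"
    using assms by (subst card_Diff_subset) auto
  ultimately show "n + 2 \<le> mvc (broom n d) + d" using assms by linarith
qed

theorem proposition2p3:
  fixes G :: "('a, 'b) pre_digraph" and n d :: nat
  assumes "graph G" and "Digraph_Component.connected G"
    and "card (verts G) = n" and "graph_diameter G = d"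
  shows "(mvc G = n \<longleftrightarrow> d \<le> 2) \<and>
    (d \<ge> 3 \<longrightarrow> int (mvc G) \<le> int n - int d + 2) \<and>
    (\<forall>n d :: nat. 3 \<le> d \<and> d \<le> n - 1 \<longrightarrow>
       (\<exists>G\<^sub>0 :: (nat, nat \<times> nat) pre_digraph.
          graph G\<^sub>0 \<and> Digraph_Component.connected G\<^sub>0 \<and> card (verts G\<^sub>0) = n \<and> graph_diameter G\<^sub>0 = d \<and>
          int (mvc G\<^sub>0) = int n - int d + 2))"
proof (intro conjI)
  interpret graph G by (rule assms(1))
  show "mvc G = n \<longleftrightarrow> d \<le> 2"
    using mvc_eq_card_verts_iff[OF assms(2)] assms(3,4) by simp
  show "d \<ge> 3 \<longrightarrow> int (mvc G) \<le> int n - int d + 2"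
    using mvc_add_diameter_le[OF assms(2)] assms(3,4) by auto
  show "\<forall>n d :: nat. 3 \<le> d \<and> d \<le> n - 1 \<longrightarrow>
       (\<exists>G\<^sub>0 :: (nat, nat \<times> nat) pre_digraph.
          graph G\<^sub>0 \<and> Digraph_Component.connected G\<^sub>0 \<and> card (verts G\<^sub>0) = n \<and> graph_diameter G\<^sub>0 = d \<and>
          int (mvc G\<^sub>0) = int n - int d + 2)"
  proof (intro allI impI)
    fix n d :: nat
    assume "3 \<le> d \<and> d \<le> n - 1"
    then have d: "2 \<le> d" "d < n" "1 \<le> d" by auto
    have "int (mvc (broom n d)) = int n - int d + 2" using mvc_broom[OF d(1,2)] by linarith
    then show "\<exists>G\<^sub>0 :: (nat, nat \<times> nat) pre_digraph.
          graph G\<^sub>0 \<and> Digraph_Component.connected G\<^sub>0 \<and> card (verts G\<^sub>0) = n \<and> graph_diameter G\<^sub>0 = d \<and>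
          int (mvc G\<^sub>0) = int n - int d + 2"
      using graph_broom connected_broom[OF d(3,2)] diameter_broom[OF d(1,2)]
      by (intro exI[of _ "broom n d"]) (simp add: verts_broom)
  qed
qed

end
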